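(* Let $C \in \mathbb{R}^{n\times n}$ be a matrix with nonnegative entries, let $X^0 \in \mathring{\mathbb{X}}$, and let $(\alpha_k)_{k \ge 0}$ be a sequence of positive learning rates such that $$\lim_{k\to\infty}\alpha_k = 0,\qquad \sum_{k=0}^\infty \alpha_k = +\infty,\qquad \sum_{k=0}^\infty \alpha_k\,(\exp\{\alpha_k\}-1) < \infty .$$ Let $X^{k+1} = T_{\alpha_k}(X^k)$ for $k\ge 0$ be the Hedge iterates, and let $\bar X^K = \frac{1}{A_K}\sum_{k=0}^K \alpha_k X^k$ with $A_K=\sum_{k=0}^K\alpha_k$. Then $$\lim_{K\to\infty} RE(\bar X^K,\bar X^{K+1})=0 \qquad\text{and}\qquad \lim_{K\to\infty}\|\bar X^{K+1}-\bar X^K\|=0,$$ where $\|\cdot\|$ is the Euclidean norm.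
   Context: $C\in\mathbb{R}^{n\times n}$ is the payoff matrix of the symmetric bimatrix game $(C,C^T)$. $\mathbb{X}=\{X\in\mathbb{R}^n: X\ge 0,\ \sum_i X(i)=1\}$ is the simplex of mixed strategies and $\mathring{\mathbb{X}}$ is its relative interior (all coordinates positive). For $\alpha>0$ the Hedge map is $T_\alpha(X)(i) = X(i)\,\dfrac{\exp\{\alpha (CX)_i\}}{\sum_{j=1}^n X(j)\exp\{\alpha (CX)_j\}}$, $i=1,\dots,n$, where $(CX)_i$ is the $i$-th coordinate of $CX$. The relative entropy is $RE(P,Q)=\sum_{i:P(i)>0}P(i)\ln\frac{P(i)}{Q(i)}$, for probability vectors $P,Q$ with $Q(i)>0$ whenever $P(i)>0$. *)

theory Defs
  imports "HOL-Analysis.Analysis"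
begin

definition mixed_strategies :: "(real ^ 'n) set" where
  "mixed_strategies = {X. (\<forall>i. 0 \<le> X $ i) \<and> (\<Sum>i\<in>UNIV. X $ i) = 1}"

definition hedge :: "real ^ 'n ^ 'n \<Rightarrow> real \<Rightarrow> real ^ 'n \<Rightarrow> real ^ 'n" where
  "hedge C \<alpha> X =
     (\<chi> i. X $ i * (exp (\<alpha> * (C *v X) $ i) / (\<Sum>j\<in>UNIV. X $ j * exp (\<alpha> * (C *v X) $ j))))"

(* Meaningful only when Q $ i > 0 wherever P $ i > 0. *)
definition rel_entropy :: "real ^ 'n \<Rightarrow> real ^ 'n \<Rightarrow> real" where
  "rel_entropy P Q = (\<Sum>i | 0 < P $ i. P $ i * ln (P $ i / Q $ i))"

definition weighted_avg :: "(nat \<Rightarrow> real) \<Rightarrow> (nat \<Rightarrow> real ^ 'n) \<Rightarrow> nat \<Rightarrow> real ^ 'n" where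
  "weighted_avg \<alpha> X K = (1 / (\<Sum>k\<le>K. \<alpha> k)) *\<^sub>R (\<Sum>k\<le>K. \<alpha> k *\<^sub>R X k)"

lemma rel_interior_mixed_strategies:
  "rel_interior (mixed_strategies :: (real ^ 'n) set) =
     {X. (\<forall>i. 0 < X $ i) \<and> (\<Sum>i\<in>UNIV. X $ i) = 1}"
proof -
  let ?B = "Basis :: (real ^ 'n) set"
  have B: "?B = range (\<lambda>i. axis i 1)"
    by (auto simp: Basis_vec_def)
  have inj: "inj (\<lambda>i::'n. axis i (1::real))"
    by (auto simp: inj_on_def axis_eq_axis)
  have expand: "(\<Sum>b\<in>?B. u b *\<^sub>R b) = (\<chi> i. u (axis i 1))" for u
  proof -
    have "(\<Sum>b\<in>?B. u b *\<^sub>R b) = (\<Sum>i\<in>UNIV. u (axis i 1) *\<^sub>R axis i 1)"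
      unfolding B by (simp add: sum.reindex[OF inj])
    also have "\<dots> = (\<chi> i. u (axis i 1))"
    proof -
      have "u (axis j 1) * axis j 1 $ i = (if i = j then u (axis j 1) else 0)" for i j
        by (simp add: axis_def)
      then show ?thesis
        by (simp add: vec_eq_iff)
    qed
    finally show ?thesis .
  qed
  have total: "sum u ?B = (\<Sum>i\<in>UNIV. u (axis i 1))" for u :: "real ^ 'n \<Rightarrow> real"
    by (simp add: B sum.reindex[OF inj])
  have hull: "mixed_strategies = convex hull ?B"
  proof (rule set_eqI)
    fix X :: "real ^ 'n"
    show "X \<in> mixed_strategies \<longleftrightarrow> X \<in> convex hull ?B"
    proof
      assume "X \<in> mixed_strategies"
      then show "X \<in> convex hull ?B"
        unfolding convex_hull_finite[OF finite_Basis] expand total mixed_strategies_def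
        by (auto simp: B inner_axis intro!: exI[of _ "\<lambda>b. X \<bullet> b"])
    next
      assume "X \<in> convex hull ?B"
      then show "X \<in> mixed_strategies"
        unfolding convex_hull_finite[OF finite_Basis] expand total mixed_strategies_def
        by (auto simp: B)
    qed
  qed
  have "\<not> affine_dependent ?B"
    using independent_Basis affine_dependent_imp_dependent by blast
  then have "rel_interior mixed_strategies =
      {y. \<exists>u. (\<forall>x\<in>?B. 0 < u x) \<and> sum u ?B = 1 \<and> (\<Sum>x\<in>?B. u x *\<^sub>R x) = y}"
    unfolding hull by (rule rel_interior_convex_hull_explicit)
  also have "\<dots> = {X. (\<forall>i. 0 < X $ i) \<and> (\<Sum>i\<in>UNIV. X $ i) = 1}"
    unfolding expand total
  proof (intro set_eqI iffI; clarsimp simp: B)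
    fix X :: "real ^ 'n"
    assume "\<forall>i. 0 < X $ i" "(\<Sum>i\<in>UNIV. X $ i) = 1"
    then show "\<exists>u :: real ^ 'n \<Rightarrow> real. (\<forall>i. 0 < u (axis i 1)) \<and> (\<Sum>i\<in>UNIV. u (axis i 1)) = 1 \<and>
        (\<chi> i. u (axis i 1)) = X"
      by (intro exI[of _ "\<lambda>b. X \<bullet> b"]) (simp add: inner_axis)
  qed
  finally show ?thesis .
qed

end

(* The averaged iterate avg_(K+1) is the convex combination of avg_K and X^(K+1) with weights
   c_K = A_K / A_(K+1) and 1 - c_K, so it dominates c_K avg_K coordinatewise. Hence
   0 \<le> RE (avg_K, avg_(K+1)) \<le> - ln c_K, and the norm of the increment is at most 2 (1 - c_K).
   Finally c_K tends to 1 because \<alpha> tends to 0 and A to infinity. *)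
theory Submission
  imports Defs
begin

text \<open>The Euclidean norm is at most the l1 norm, which equals 1 on the simplex.\<close>

lemma norm_mixed_strategies_le_1:
  fixes P :: "real ^ 'n"
  assumes "P \<in> mixed_strategies"
  shows "norm P \<le> 1"
  using norm_le_l1_cart[of P] assms by (simp add: mixed_strategies_def)

lemma convex_mixed_strategies: "convex (mixed_strategies :: (real ^ 'n) set)"
  unfolding convex_def mixed_strategies_def
  by (auto simp: sum.distrib simp flip: sum_distrib_left)

lemma hedge_mixed_strategies:
  fixes P :: "real ^ 'n"
  assumes "P \<in> mixed_strategies"
  shows "hedge C a P \<in> mixed_strategies"
proof -
  define w where "w j = P $ j * exp (a * (C *v P) $ j)" for j
  have P: "0 \<le> P $ j" "(\<Sum>j\<in>UNIV. P $ j) = 1" for j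
    using assms by (auto simp: mixed_strategies_def)
  have w: "0 \<le> w j" for j
    by (simp add: w_def P)
  \<comment> \<open>The normalizer must not vanish, or division by zero would send \<open>P\<close>
    to the zero vector. Exponentials are positive, so vanishing weights would force
    \<open>P = 0\<close>, against total mass 1.\<close>
  have "sum w UNIV \<noteq> 0"
  proof
    assume "sum w UNIV = 0"
    then have "P $ j = 0" for j
      using w by (auto simp: sum_nonneg_eq_0_iff w_def)
    then show False
      using P(2) by simp
  qed
  then have "(\<Sum>i\<in>UNIV. w i / sum w UNIV) = 1"
    by (simp flip: sum_divide_distrib)
  moreover have "0 \<le> w i / sum w UNIV" for i
    by (simp add: w sum_nonneg)
  moreover have "hedge C a P = (\<chi> i. w i / sum w UNIV)"
    by (simp add: hedge_def w_def)
  ultimately show ?thesis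
    by (simp add: mixed_strategies_def)
qed

text \<open>Gibbs' inequality: ln x \<le> x - 1 at x = \<open>Q $ i / P $ i\<close> bounds each term
  from below by \<open>P $ i - Q $ i\<close>.\<close>

lemma rel_entropy_nonneg:
  fixes P Q :: "real ^ 'n"
  assumes "P \<in> mixed_strategies" "Q \<in> mixed_strategies"
    and ac: "\<And>i. 0 < P $ i \<Longrightarrow> 0 < Q $ i"
  shows "0 \<le> rel_entropy P Q"
proof -
  have P: "0 \<le> P $ i" "(\<Sum>i\<in>UNIV. P $ i) = 1" and Q: "0 \<le> Q $ i" "(\<Sum>i\<in>UNIV. Q $ i) = 1" for i
    using assms by (auto simp: mixed_strategies_def)
  have "P $ i - Q $ i \<le> P $ i * ln (P $ i / Q $ i)" if "0 < P $ i" for i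
  proof -
    have "ln (Q $ i / P $ i) \<le> Q $ i / P $ i - 1"
      using that ac by (intro ln_le_minus_one) simp
    then have "P $ i * ln (Q $ i / P $ i) \<le> P $ i * (Q $ i / P $ i - 1)"
      using that by (intro mult_left_mono) auto
    then show ?thesis
      using that ac[OF that] by (simp add: ln_div algebra_simps)
  qed
  then have "(\<Sum>i | 0 < P $ i. P $ i - Q $ i) \<le> rel_entropy P Q"
    unfolding rel_entropy_def by (intro sum_mono) simp
  \<comment> \<open>Restricting to the support of \<open>P\<close> keeps all the mass of
    \<open>P\<close> but may lose mass of \<open>Q\<close>, so the lower bound is at least 1 - 1 =
    0.\<close>
  moreover have "(\<Sum>i | 0 < P $ i. P $ i) = (\<Sum>i\<in>UNIV. P $ i)"
    using P(1) by (intro sum.mono_neutral_left) (auto simp: not_less intro: antisym)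
  moreover have "(\<Sum>i | 0 < P $ i. Q $ i) \<le> (\<Sum>i\<in>UNIV. Q $ i)"
    using Q(1) by (intro sum_mono2) auto
  ultimately show ?thesis
    using P(2) Q(2) by (simp add: sum_subtractf)
qed

text \<open>Domination makes \<open>Q\<close> positive on the support of \<open>P\<close> and keeps
  every ratio \<open>P $ i / Q $ i\<close> there at most 1/c; averaging the logarithms with weights
  \<open>P $ i\<close> preserves the bound.\<close>

lemma rel_entropy_le_minus_ln:
  fixes P Q :: "real ^ 'n"
  assumes "P \<in> mixed_strategies" "0 < c" and le: "\<And>i. c * P $ i \<le> Q $ i"
  shows "rel_entropy P Q \<le> - ln c"
proof -
  have P: "0 \<le> P $ i" "(\<Sum>i\<in>UNIV. P $ i) = 1" for i
    using assms by (auto simp: mixed_strategies_def)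
  have "P $ i * ln (P $ i / Q $ i) \<le> P $ i * - ln c" if "0 < P $ i" for i
  proof -
    have "0 < c * P $ i"
      using that \<open>0 < c\<close> by simp
    then have "0 < Q $ i" "ln (c * P $ i) \<le> ln (Q $ i)"
      using le[of i] by auto
    then have "ln (P $ i / Q $ i) \<le> - ln c"
      using that \<open>0 < c\<close> by (simp add: ln_div ln_mult)
    then show ?thesis
      using that by (intro mult_left_mono) auto
  qed
  then have "rel_entropy P Q \<le> (\<Sum>i | 0 < P $ i. P $ i * - ln c)"
    unfolding rel_entropy_def by (intro sum_mono) simp
  also have "\<dots> = (\<Sum>i\<in>UNIV. P $ i * - ln c)"
    using P(1) by (intro sum.mono_neutral_left) (auto simp: not_less intro: antisym)
  also have "\<dots> = - ln c"
    by (subst sum_distrib_right[symmetric]) (simp add: P(2))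
  finally show ?thesis .
qed

lemma weighted_avg_Suc:
  fixes X :: "nat \<Rightarrow> real ^ 'n"
  assumes "(\<Sum>k\<le>K. \<alpha> k) \<noteq> 0" "(\<Sum>k\<le>Suc K. \<alpha> k) \<noteq> 0"
  defines "c \<equiv> (\<Sum>k\<le>K. \<alpha> k) / (\<Sum>k\<le>Suc K. \<alpha> k)"
  shows "weighted_avg \<alpha> X (Suc K) = c *\<^sub>R weighted_avg \<alpha> X K + (1 - c) *\<^sub>R X (Suc K)"
proof -
  have "1 - c = \<alpha> (Suc K) / (\<Sum>k\<le>Suc K. \<alpha> k)"
    using assms by (simp add: c_def field_simps)
  then show ?thesis
    using assms by (simp add: weighted_avg_def c_def scaleR_add_right)
qed

text \<open>The coefficients \<open>\<alpha> k / (\<Sum>k\<le>K. \<alpha> k)\<close> are nonnegative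
  and sum to 1.\<close>

lemma weighted_avg_in_convex:
  fixes X :: "nat \<Rightarrow> real ^ 'n"
  assumes "convex S" "\<And>k. X k \<in> S" "\<And>k. 0 \<le> \<alpha> k" "(\<Sum>k\<le>K. \<alpha> k) \<noteq> 0"
  shows "weighted_avg \<alpha> X K \<in> S"
proof -
  have "(\<Sum>k\<le>K. (\<alpha> k / (\<Sum>k\<le>K. \<alpha> k)) *\<^sub>R X k) \<in> S"
    using assms by (intro convex_sum) (auto simp: sum_nonneg simp flip: sum_divide_distrib)
  then show ?thesis
    by (simp add: weighted_avg_def scaleR_sum_right)
qed

theorem lemma22:
  fixes C :: "real ^ 'n ^ 'n"
    and \<alpha> :: "nat \<Rightarrow> real"
    and X :: "nat \<Rightarrow> real ^ 'n"
  assumes "\<And>i j. 0 \<le> C $ i $ j"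
    and "X 0 \<in> rel_interior mixed_strategies"
    and "\<And>k. X (Suc k) = hedge C (\<alpha> k) (X k)"
    and "\<And>k. 0 < \<alpha> k"
    and "\<alpha> \<longlonglongrightarrow> 0"
    and "filterlim (\<lambda>K. \<Sum>k\<le>K. \<alpha> k) at_top sequentially"
    and "summable (\<lambda>k. \<alpha> k * (exp (\<alpha> k) - 1))"
  shows "((\<lambda>K. rel_entropy (weighted_avg \<alpha> X K) (weighted_avg \<alpha> X (Suc K))) \<longlonglongrightarrow> 0) \<and>
         ((\<lambda>K. norm (weighted_avg \<alpha> X (Suc K) - weighted_avg \<alpha> X K)) \<longlonglongrightarrow> 0)"
proof -
  define A where "A K = (\<Sum>k\<le>K. \<alpha> k)" for K
  define c where "c K = A K / A (Suc K)" for K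
  let ?avg = "weighted_avg \<alpha> X"
  have A_pos: "0 < A K" for K
    unfolding A_def using assms(4) by (intro sum_pos) auto
  have X: "X k \<in> mixed_strategies" for k
  proof (induction k)
    case 0
    show ?case
      using assms(2) rel_interior_subset by blast
  next
    case (Suc k)
    then show ?case
      by (simp add: assms(3) hedge_mixed_strategies)
  qed
  have avg: "?avg K \<in> mixed_strategies" for K
    using A_pos[of K] X assms(4)
    by (intro weighted_avg_in_convex convex_mixed_strategies) (auto simp: A_def less_imp_le)
  have avg_Suc: "?avg (Suc K) = c K *\<^sub>R ?avg K + (1 - c K) *\<^sub>R X (Suc K)" for K
    unfolding c_def A_def
    using A_pos[of K] A_pos[of "Suc K"] by (intro weighted_avg_Suc) (simp_all add: A_def)
  \<comment> \<open>In this form the limit of \<open>c\<close> reduces to that of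
    \<open>\<alpha> K / A K\<close>, shifted by one index.\<close>
  have c_eq: "c = (\<lambda>K. 1 - \<alpha> (Suc K) / A (Suc K))"
  proof
    show "c K = 1 - \<alpha> (Suc K) / A (Suc K)" for K
      using A_pos[of "Suc K"] by (simp add: c_def A_def field_simps)
  qed
  have c: "0 < c K" "c K \<le> 1" for K
    using A_pos[of K] A_pos[of "Suc K"] assms(4)[of "Suc K"] by (auto simp: c_def A_def)
  have "(\<lambda>K. \<alpha> K / A K) \<longlonglongrightarrow> 0"
    using assms(5,6) unfolding A_def by (rule real_tendsto_divide_at_top)
  then have c_lim: "c \<longlonglongrightarrow> 1"
    unfolding c_eq using tendsto_diff[OF tendsto_const LIMSEQ_Suc, of _ 0 1] by simp

  \<comment> \<open>The discarded term \<open>(1 - c K) * X (Suc K) $ i\<close> is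
    nonnegative.\<close>
  have dom: "c K * ?avg K $ i \<le> ?avg (Suc K) $ i" for K i
    using X[of "Suc K"] c[of K] by (simp add: avg_Suc mixed_strategies_def)
  have "(\<lambda>K. rel_entropy (?avg K) (?avg (Suc K))) \<longlonglongrightarrow> 0"
  proof (rule tendsto_sandwich[OF _ _ tendsto_const])
    have "0 \<le> rel_entropy (?avg K) (?avg (Suc K))" for K
    proof (rule rel_entropy_nonneg)
      \<comment> \<open>Since \<open>c K\<close> is positive, domination carries positivity over to
        the next average, so the relative entropy is meaningful here.\<close>
      show "0 < ?avg (Suc K) $ i" if "0 < ?avg K $ i" for i
        using dom[of K i] mult_pos_pos[OF c(1)[of K] that] by linarith
    qed (rule avg)+
    then show "\<forall>\<^sub>F K in sequentially. 0 \<le> rel_entropy (?avg K) (?avg (Suc K))"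
      by simp
    show "\<forall>\<^sub>F K in sequentially. rel_entropy (?avg K) (?avg (Suc K)) \<le> - ln (c K)"
      using rel_entropy_le_minus_ln[OF avg c(1) dom] by simp
    show "(\<lambda>K. - ln (c K)) \<longlonglongrightarrow> 0"
      using tendsto_minus[OF tendsto_ln[OF c_lim]] by simp
  qed
  moreover have "(\<lambda>K. norm (?avg (Suc K) - ?avg K)) \<longlonglongrightarrow> 0"
  proof (rule tendsto_sandwich[OF _ _ tendsto_const])
    \<comment> \<open>The increment is \<open>1 - c K\<close> times a difference of two points of
      the simplex; each has norm at most 1, whence the factor 2.\<close>
    have "norm (?avg (Suc K) - ?avg K) \<le> (1 - c K) * 2" for K
    proof -
      have "?avg (Suc K) - ?avg K = (1 - c K) *\<^sub>R (X (Suc K) - ?avg K)"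
        by (simp add: avg_Suc algebra_simps)
      then have "norm (?avg (Suc K) - ?avg K) = (1 - c K) * norm (X (Suc K) - ?avg K)"
        using c(2)[of K] by simp
      also have "\<dots> \<le> (1 - c K) * 2"
        using c(2)[of K] norm_triangle_ineq4[of "X (Suc K)" "?avg K"]
          norm_mixed_strategies_le_1[OF X[of "Suc K"]] norm_mixed_strategies_le_1[OF avg[of K]]
        by (intro mult_left_mono) auto
      finally show ?thesis .
    qed
    then show "\<forall>\<^sub>F K in sequentially. norm (?avg (Suc K) - ?avg K) \<le> (1 - c K) * 2"
      by simp
    show "(\<lambda>K. (1 - c K) * 2) \<longlonglongrightarrow> 0"
      using tendsto_mult_right[OF tendsto_diff[OF tendsto_const c_lim], of 1 2] by simp
  qed simp
  ultimately show ?thesis ..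
qed

end
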